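(* $$ 8 \operatorname{Li}_2\left(2-\sqrt{3}\right)-\operatorname{Li}_2\left(4 \sqrt{3} - 7 \right) = \frac{5 \pi ^2}{12}+\ln \left(2-\sqrt{3}\right) \ln \left(2+\sqrt{3}\right). $$
   Context: $\operatorname{Li}_2(x)=\sum_{n\ge1}x^n/n^2$ for $|x|\le1$ is the dilogarithm. *)

theory Defs
  imports "HOL-Analysis.Analysis"
begin

text \<open>The series is indexed from 0, so the summand for index \<open>n\<close> is the one for \<open>Suc n\<close> in
  \<open>\<Sum>n\<ge>1. x ^ n / n\<^sup>2\<close>. Only values with \<open>\<bar>x\<bar> \<le> 1\<close> are meaningful; outside this
  range \<open>suminf\<close> of the divergent series is an unspecified value.\<close>

definition Li2 :: "real \<Rightarrow> real" where
  "Li2 x = (\<Sum>n. x ^ Suc n / (real (Suc n))\<^sup>2)"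

lemma Li2_sums:
  assumes "\<bar>x\<bar> \<le> 1"
  shows "(\<lambda>n. x ^ Suc n / (real (Suc n))\<^sup>2) sums Li2 x"
proof -
  have "summable (\<lambda>n. 1 / (real n)\<^sup>2)"
    using inverse_power_summable[of 2, where 'a = real] by (simp add: field_simps)
  then have "summable (\<lambda>n. 1 / (real (Suc n))\<^sup>2)"
    by (subst summable_Suc_iff)
  moreover have "norm (x ^ Suc n / (real (Suc n))\<^sup>2) \<le> 1 / (real (Suc n))\<^sup>2" for n
  proof -
    have "\<bar>x\<bar> ^ Suc n \<le> 1"
      using assms by (intro power_le_one) auto
    then show ?thesis
      by (simp add: power_abs abs_mult divide_right_mono del: power_Suc of_nat_Suc)
  qed
  ultimately have "summable (\<lambda>n. x ^ Suc n / (real (Suc n))\<^sup>2)"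
    by (rule summable_comparison_test'[where N = 0])
  then show ?thesis
    unfolding Li2_def by (rule summable_sums)
qed

end

theory Submission
  imports Defs "HOL-Real_Asymp.Real_Asymp"
begin

text \<open>The proof works with the Rogers dilogarithm \<open>L x = Li\<^sub>2 x + ln x ln (1 - x) / 2\<close> on \<open>[0, 1]\<close>,
  which satisfies the reflection formula \<open>L x + L (1 - x) = \<pi>\<^sup>2 / 6\<close> and Abel's five-term relation.
  Put \<open>a = 2 - \<surd>3\<close>. Since \<open>4 \<surd>3 - 7 = - a\<^sup>2\<close> and \<open>1 + a\<^sup>2 = 4 a\<close>, Landen's transformation sends
  \<open>Li\<^sub>2 (- a\<^sup>2)\<close> to \<open>Li\<^sub>2 (a / 4)\<close>, and the claim becomes \<open>8 L a + L (a / 4) = 5 \<pi>\<^sup>2 / 12\<close>. This is an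
  integer combination of five instances of the five-term relation whose arguments, together with
  their complements to 1, are units of \<open>\<int>[\<surd>3]\<close> away from 2 and 3.\<close>

section \<open>The dilogarithm: values, continuity, derivative, Landen's transformation\<close>

lemma Li2_0 [simp]: "Li2 0 = 0"
  unfolding Li2_def by simp

lemma Li2_1: "Li2 1 = pi\<^sup>2 / 6"
proof -
  have "(\<lambda>n. 1 ^ Suc n / (real (Suc n))\<^sup>2) sums Li2 1"
    by (rule Li2_sums) simp
  then have "(\<lambda>n. 1 / real ((n + 1)\<^sup>2)) sums Li2 1"
    by (simp add: add.commute)
  then show ?thesis
    using inverse_squares_sums by (rule sums_unique2)
qed

text \<open>The majorant \<open>1 / n\<^sup>2\<close> does not depend on \<open>x\<close>, so
  convergence is uniform up to the endpoints.\<close>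

lemma continuous_on_Li2: "continuous_on {-1..1} Li2"
proof -
  have sm: "summable (\<lambda>n. 1 / (real (Suc n))\<^sup>2)"
    using sums_summable[OF Li2_sums[of 1]] by simp
  have "uniform_limit {-1..1::real} (\<lambda>n x. \<Sum>i<n. x ^ Suc i / (real (Suc i))\<^sup>2)
          (\<lambda>x. \<Sum>i. x ^ Suc i / (real (Suc i))\<^sup>2) sequentially"
  proof (rule Weierstrass_m_test[OF _ sm])
    fix n and x :: real assume "x \<in> {-1..1}"
    then have "\<bar>x\<bar> ^ Suc n \<le> 1"
      by (intro power_le_one) auto
    then show "norm (x ^ Suc n / (real (Suc n))\<^sup>2) \<le> 1 / (real (Suc n))\<^sup>2"
      by (simp add: power_abs abs_mult divide_right_mono del: power_Suc of_nat_Suc)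
  qed
  then have "continuous_on {-1..1::real} (\<lambda>x. \<Sum>i. x ^ Suc i / (real (Suc i))\<^sup>2)"
    by (rule uniform_limit_theorem[rotated])
       (auto intro!: always_eventually continuous_intros simp del: power_Suc of_nat_Suc)
  then show ?thesis
    unfolding Li2_def .
qed

lemma Li2_has_real_derivative:
  assumes "\<bar>x\<bar> < 1" "x \<noteq> 0"
  shows "(Li2 has_real_derivative - ln (1 - x) / x) (at x)"
proof -
  \<comment> \<open>Division by zero gives \<open>c 0 = 0\<close>, so the power series with
    coefficients \<open>c\<close> can start at index 0.\<close>
  define c :: "nat \<Rightarrow> real" where "c n = 1 / (real n)\<^sup>2" for n
  have eq: "(\<lambda>n. c n * y ^ n) sums Li2 y" if "\<bar>y\<bar> \<le> 1" for y
    using Li2_sums[OF that] sums_Suc_iff[of "\<lambda>n. c n * y ^ n" "Li2 y"] by (simp add: c_def)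
  have "((\<lambda>y. \<Sum>n. c n * y ^ n) has_real_derivative (\<Sum>n. diffs c n * x ^ n)) (at x)"
  proof (rule termdiffs_strong)
    show "summable (\<lambda>n. c n * 1 ^ n)"
      using sums_summable[OF eq[of 1]] by simp
  qed (use assms in simp)
  then have D: "(Li2 has_real_derivative (\<Sum>n. diffs c n * x ^ n)) (at x)"
  proof (rule has_field_derivative_transform_within_open[where S = "{-1<..<1}"])
    fix y :: real assume "y \<in> {-1<..<1}"
    then show "(\<Sum>n. c n * y ^ n) = Li2 y"
      using sums_unique[OF eq[of y]] by (simp add: abs_le_iff)
  qed (use assms in auto)
  have "(\<lambda>n. - (x ^ n / real n)) sums ln (1 - x)"
    using ln_series'[of "- x"] assms by simp
  \<comment> \<open>The index shift costs nothing, because the term at 0 is a division by zero and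
    hence 0.\<close>
  then have "(\<lambda>n. - (x ^ Suc n / real (Suc n))) sums ln (1 - x)"
    by (subst sums_Suc_iff) simp
  from sums_mult[OF this, of "- 1 / x"]
  have "(\<lambda>n. x ^ n / real (Suc n)) sums (- ln (1 - x) / x)"
    using assms by (simp add: field_simps)
  moreover have "diffs c n * x ^ n = x ^ n / real (Suc n)" for n
    by (simp add: diffs_def c_def power2_eq_square del: of_nat_Suc)
  ultimately show ?thesis
    using D sums_unique by force
qed

text \<open>Common scheme of all functional equations below: differentiate in one variable and
  evaluate at 0. Only continuity is asked at the ends, where the derivatives involved may be
  singular.\<close>

lemma DERIV_zero_imp_eq_at_0:
  fixes f :: "real \<Rightarrow> real"
  assumes "0 < x" "continuous_on {0..x} f"
    and "\<And>t. 0 < t \<Longrightarrow> t < x \<Longrightarrow> (f has_real_derivative 0) (at t)"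
  shows "f x = f 0"
  using DERIV_isconst_end[OF assms] .

text \<open>Since \<open>1 - z / (1 + z) = 1 / (1 + z)\<close>, all derivatives are multiples of
  \<open>ln (1 + z)\<close>, with coefficients \<open>-1/z\<close>, \<open>1/(z * (1 + z))\<close>
  and \<open>1/(1 + z)\<close>, whose sum is 0.\<close>

lemma Li2_Landen:
  assumes "0 < z" "z < 1"
  shows "Li2 (- z) + Li2 (z / (1 + z)) = - (ln (1 + z))\<^sup>2 / 2"
proof -
  let ?f = "\<lambda>z. Li2 (- z) + Li2 (z / (1 + z)) + (ln (1 + z))\<^sup>2 / 2"
  have "?f z = ?f 0"
  proof (rule DERIV_zero_imp_eq_at_0)
    show "continuous_on {0..z} ?f"
      by (intro continuous_intros continuous_on_compose2[OF continuous_on_Li2])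
         (use assms in \<open>auto simp: field_simps\<close>)
    fix t assume t: "0 < t" "t < z"
    have w: "\<bar>t / (1 + t)\<bar> < 1" "t / (1 + t) \<noteq> 0" and "1 - t / (1 + t) = inverse (1 + t)"
      using t by (auto simp: field_simps)
    then have l: "ln (1 - t / (1 + t)) = - ln (1 + t)"
      using t by (simp add: ln_inverse)
    have 1: "((\<lambda>t. Li2 (- t)) has_real_derivative (- ln (1 - (- t)) / (- t)) * (- 1)) (at t)"
      by (rule DERIV_chain2[OF Li2_has_real_derivative]) (use t assms in \<open>auto intro!: derivative_eq_intros\<close>)
    have 2: "((\<lambda>t. Li2 (t / (1 + t))) has_real_derivative
        (- ln (1 - t / (1 + t)) / (t / (1 + t))) * (1 / (1 + t)\<^sup>2)) (at t)"
      by (rule DERIV_chain2[where g = "\<lambda>t. t / (1 + t)", OF Li2_has_real_derivative[OF w]])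
         (use t in \<open>auto intro!: derivative_eq_intros simp: power2_eq_square field_simps\<close>)
    have 3: "((\<lambda>t. (ln (1 + t))\<^sup>2 / 2) has_real_derivative ln (1 + t) / (1 + t)) (at t)"
      using t by (auto intro!: derivative_eq_intros simp: field_simps)
    have "(- ln (1 - (- t)) / (- t)) * (- 1) + (- ln (1 - t / (1 + t)) / (t / (1 + t))) * (1 / (1 + t)\<^sup>2)
        + ln (1 + t) / (1 + t) = 0"
      unfolding l using t by (simp add: divide_simps power2_eq_square) (simp add: algebra_simps)
    then show "(?f has_real_derivative 0) (at t)"
      using DERIV_add[OF DERIV_add[OF 1 2] 3] by simp
  qed (use assms in auto)
  then show ?thesis
    by simp
qed

section \<open>The Rogers dilogarithm and its functional equations\<close>

text \<open>At 0 and 1 the junk value \<open>ln 0\<close> is multiplied by \<open>ln 1 = 0\<close>, so this agrees with the continuous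
  extension to \<open>[0, 1]\<close>.\<close>

definition rogers_L :: "real \<Rightarrow> real" where
  "rogers_L x = Li2 x + ln x * ln (1 - x) / 2"

lemma rogers_L_0 [simp]: "rogers_L 0 = 0"
  by (simp add: rogers_L_def)

lemma rogers_L_1: "rogers_L 1 = pi\<^sup>2 / 6"
  by (simp add: rogers_L_def Li2_1)

lemma continuous_on_rogers_L: "continuous_on {0..1} rogers_L"
proof -
  have "continuous (at x within {0..1}) (\<lambda>x::real. ln x * ln (1 - x))" if x: "x \<in> {0..1}" for x
  proof -
    consider "x = 0" | "x = 1" | "0 < x" "x < 1"
      using x by fastforce
    then show ?thesis
    proof cases
      case 1
      \<comment> \<open>One factor vanishes linearly and beats the logarithmic singularity of the
        other; the limit is the value at the endpoint.\<close>
      have "((\<lambda>x::real. ln x * ln (1 - x)) \<longlongrightarrow> 0) (at_right 0)"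
        by real_asymp
      then show ?thesis
        unfolding continuous_within using 1 by (simp add: at_within_Icc_at_right)
    next
      case 2
      have "((\<lambda>x::real. ln x * ln (1 - x)) \<longlongrightarrow> 0) (at_left 1)"
        by real_asymp
      then show ?thesis
        unfolding continuous_within using 2 by (simp add: at_within_Icc_at_left)
    next
      case 3
      then show ?thesis
        by (intro continuous_intros) auto
    qed
  qed
  then have "continuous_on {0..1} (\<lambda>x::real. ln x * ln (1 - x))"
    by (simp add: continuous_on_eq_continuous_within)
  moreover have "continuous_on {0..1} Li2"
    by (rule continuous_on_subset[OF continuous_on_Li2]) auto
  ultimately show ?thesis
    unfolding rogers_L_def by (intro continuous_on_add continuous_on_divide continuous_on_const) auto
qed

lemma rogers_L_has_real_derivative:
  assumes "0 < x" "x < 1"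
  shows "(rogers_L has_real_derivative - (ln (1 - x) / x + ln x / (1 - x)) / 2) (at x)"
  unfolding rogers_L_def using assms
  by (auto intro!: derivative_eq_intros Li2_has_real_derivative simp: field_simps)

lemma rogers_L_chain:
  assumes "0 < g x" "g x < 1" "(g has_real_derivative d) (at x)"
  shows "((\<lambda>x. rogers_L (g x)) has_real_derivative
    - (ln (1 - g x) / g x + ln (g x) / (1 - g x)) / 2 * d) (at x)"
  using DERIV_chain2[OF rogers_L_has_real_derivative assms(3)] assms by simp

text \<open>The derivative of \<open>rogers_L\<close> is invariant under \<open>x\<close> to
  \<open>1 - x\<close>, so the sum is constant; its value at 0 is \<open>rogers_L 1\<close>.\<close>

lemma rogers_L_reflect:
  assumes "0 < x" "x < 1"
  shows "rogers_L x + rogers_L (1 - x) = pi\<^sup>2 / 6"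
proof -
  let ?f = "\<lambda>x. rogers_L x + rogers_L (1 - x)"
  have "?f x = ?f 0"
  proof (rule DERIV_zero_imp_eq_at_0)
    show "continuous_on {0..x} ?f"
      by (intro continuous_intros continuous_on_compose2[OF continuous_on_rogers_L])
         (use assms in auto)
    fix t assume t: "0 < t" "t < x"
    have "((\<lambda>t. rogers_L (1 - t)) has_real_derivative
        - (ln (1 - (1 - t)) / (1 - t) + ln (1 - t) / (1 - (1 - t))) / 2 * (- 1)) (at t)"
      by (rule rogers_L_chain) (use t assms in \<open>auto intro!: derivative_eq_intros\<close>)
    from DERIV_add[OF rogers_L_has_real_derivative this]
    show "(?f has_real_derivative 0) (at t)"
      using t assms by (simp add: add.commute)
  qed (use assms in auto)
  then show ?thesis
    by (simp add: rogers_L_1)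
qed

text \<open>With \<open>y\<close> fixed, the difference of the two sides vanishes at
  \<open>x = 0\<close>, where the last argument becomes \<open>y\<close>. Its derivative in
  \<open>x\<close> is a combination of five logarithms with rational coefficients, each of which
  cancels.\<close>

lemma rogers_L_five_term:
  assumes "0 < x" "x < 1" "0 < y" "y < 1"
  shows "rogers_L x + rogers_L y =
    rogers_L (x * y) + rogers_L (x * (1 - y) / (1 - x * y)) + rogers_L (y * (1 - x) / (1 - x * y))"
proof -
  let ?p = "\<lambda>x. x * (1 - y) / (1 - x * y)" and ?q = "\<lambda>x. y * (1 - x) / (1 - x * y)"
  let ?f = "\<lambda>x. rogers_L x + rogers_L y - rogers_L (x * y) - rogers_L (?p x) - rogers_L (?q x)"
  have xy: "t * y < 1" if "0 \<le> t" "t < 1" for t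
    using mult_strict_mono'[of t 1 y 1] that assms by simp
  have "?f x = ?f 0"
  proof (rule DERIV_zero_imp_eq_at_0)
    have bnd: "t * y < 1" "t * y \<in> {0..1}" "?p t \<in> {0..1}" "?q t \<in> {0..1}" if "t \<in> {0..x}" for t
    proof -
      show l: "t * y < 1"
        using xy[of t] that assms by simp
      then show "t * y \<in> {0..1}"
        using that assms by simp
      have "0 \<le> t * (1 - y)" "0 \<le> y * (1 - t)"
        using that assms by simp_all
      with l show "?p t \<in> {0..1}" "?q t \<in> {0..1}"
        using that assms by (auto simp: divide_simps algebra_simps)
    qed
    show "continuous_on {0..x} ?f"
      by (intro continuous_intros continuous_on_compose2[OF continuous_on_rogers_L])
         (use assms bnd in \<open>force simp del: atLeastAtMost_iff | force\<close>)+
    fix t assume t: "0 < t" "t < x"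
    have t1: "t < 1" and d: "0 < 1 - t * y"
      using t assms xy[of t] by simp_all
    \<comment> \<open>The complements factor too, so every logarithm expands into \<open>X\<close>,
      \<open>Y\<close>, \<open>A\<close>, \<open>B\<close>, \<open>C\<close>.\<close>
    have pq1: "1 - ?p t = (1 - t) / (1 - t * y)" "1 - ?q t = (1 - y) / (1 - t * y)"
      using d by (simp_all add: divide_simps) (simp_all add: algebra_simps)
    have pq: "0 < ?p t" "?p t < 1" "0 < ?q t" "?q t < 1"
      using t t1 d assms by (auto simp: divide_simps algebra_simps)
    define X Y A B C where "X = ln t" "Y = ln y" "A = ln (1 - t)" "B = ln (1 - y)" "C = ln (1 - t * y)"
    note abbr = X_Y_A_B_C_def
    have ln_eqs: "ln (t * y) = X + Y" "ln (?p t) = X + B - C" "ln (?q t) = Y + A - C"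
      "ln (1 - ?p t) = A - C" "ln (1 - ?q t) = B - C"
      unfolding pq1 abbr using t t1 d assms by (simp_all add: ln_mult ln_div)
    have 1: "((\<lambda>t. rogers_L t) has_real_derivative - (A / t + X / (1 - t)) / 2) (at t)"
      using rogers_L_has_real_derivative[of t] t t1 unfolding abbr by simp
    have 2: "((\<lambda>t. rogers_L (t * y)) has_real_derivative
        - (C / (t * y) + (X + Y) / (1 - t * y)) / 2 * y) (at t)"
      unfolding abbr ln_eqs(1)[unfolded abbr, symmetric]
      by (rule rogers_L_chain) (use t d assms in \<open>auto intro!: derivative_eq_intros\<close>)
    have 3: "((\<lambda>t. rogers_L (?p t)) has_real_derivative
        - ((A - C) / ?p t + (X + B - C) / (1 - ?p t)) / 2 * ((1 - y) / (1 - t * y)\<^sup>2)) (at t)"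
      unfolding ln_eqs[symmetric]
      by (rule rogers_L_chain[where g = ?p, OF pq(1,2)])
         (use d in \<open>auto intro!: derivative_eq_intros simp: divide_simps power2_eq_square algebra_simps\<close>)
    have 4: "((\<lambda>t. rogers_L (?q t)) has_real_derivative
        - ((B - C) / ?q t + (Y + A - C) / (1 - ?q t)) / 2 * (- (y * (1 - y)) / (1 - t * y)\<^sup>2)) (at t)"
      unfolding ln_eqs[symmetric]
      by (rule rogers_L_chain[where g = ?q, OF pq(3,4)])
         (use d in \<open>auto intro!: derivative_eq_intros simp: divide_simps power2_eq_square algebra_simps\<close>)
    have "- (A / t + X / (1 - t)) / 2 + 0 - - (C / (t * y) + (X + Y) / (1 - t * y)) / 2 * y
      - - ((A - C) / ?p t + (X + B - C) / (1 - ?p t)) / 2 * ((1 - y) / (1 - t * y)\<^sup>2)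
      - - ((B - C) / ?q t + (Y + A - C) / (1 - ?q t)) / 2 * (- (y * (1 - y)) / (1 - t * y)\<^sup>2) = 0"
      (is "?D = 0")
    proof -
      define d where "d = 1 - t * y"
      define u v where "u = 1 - t" "v = 1 - y"
      have nz: "t \<noteq> 0" "y \<noteq> 0" "d \<noteq> 0" "u \<noteq> 0" "v \<noteq> 0"
        using t t1 \<open>0 < 1 - t * y\<close> assms by (auto simp: d_def u_v_def)
      \<comment> \<open>Distributes the chain-rule factors over the logarithmic terms, so that
        \<open>m\<close> can simplify each product.\<close>
      have ring: "- (k1 + k2) / 2 + 0 - - (k3 + k4) / 2 * m1 - - (k5 + k6) / 2 * m2 - - (k7 + k8) / 2 * m3
        = (- (k1 + k2) + (k3 * m1 + k4 * m1) + (k5 * m2 + k6 * m2) + (k7 * m3 + k8 * m3)) / 2"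
        for k1 k2 k3 k4 k5 k6 k7 k8 m1 m2 m3 :: real
        by (simp add: field_simps)
      \<comment> \<open>Partial fractions: all coefficients become combinations of
        \<open>1 / t\<close>, \<open>1 / u\<close> and \<open>y / d\<close>.\<close>
      have e: "1 / (t * d) = 1 / t + y / d" "v / (u * d) = 1 / u - y / d"
        using nz by (simp_all add: divide_simps) (simp_all add: d_def u_v_def algebra_simps)
      have m: "P / (t * v / d) * (v / d\<^sup>2) = P * (1 / (t * d))" "P / (u / d) * (v / d\<^sup>2) = P * (v / (u * d))"
        "P / (y * u / d) * (- (y * v) / d\<^sup>2) = - P * (v / (u * d))"
        "P / (v / d) * (- (y * v) / d\<^sup>2) = - P * (y / d)" "P / (t * y) * y = P / t" for P
        using nz by (simp_all add: power2_eq_square)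
      have "?D = (- (A / t + X / u) + (C / (t * y) * y + (X + Y) / d * y)
        + ((A - C) / (t * v / d) * (v / d\<^sup>2) + (X + B - C) / (u / d) * (v / d\<^sup>2))
        + ((B - C) / (y * u / d) * (- (y * v) / d\<^sup>2) + (Y + A - C) / (v / d) * (- (y * v) / d\<^sup>2))) / 2"
        unfolding pq1 unfolding d_def[symmetric] u_v_def[symmetric] by (rule ring)
      also have "\<dots> = 0"
        unfolding m e by (simp add: algebra_simps add_divide_distrib diff_divide_distrib)
      finally show ?thesis .
    qed
    then show "(?f has_real_derivative 0) (at t)"
      using DERIV_diff[OF DERIV_diff[OF DERIV_diff[OF DERIV_add[OF 1 DERIV_const] 2] 3] 4, of "rogers_L y"]
      by simp
  qed (use assms in auto)
  then show ?thesis
    by simp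
qed

text \<open>Cross-multiplied form: concrete instances reduce to polynomial identities in
  \<open>r\<close> modulo \<open>r * r = 3\<close>.\<close>

lemma rogers_L_five_term':
  assumes "0 < x" "x < 1" "0 < y" "y < 1"
    and "x * y = z" "p * (1 - z) = x * (1 - y)" "q * (1 - z) = y * (1 - x)"
  shows "rogers_L x + rogers_L y = rogers_L z + rogers_L p + rogers_L q"
proof -
  have "z < 1"
    using mult_strict_mono'[of x 1 y 1] assms by simp
  then have "p = x * (1 - y) / (1 - x * y)" "q = y * (1 - x) / (1 - x * y)"
    using assms by (simp_all add: field_simps)
  then show ?thesis
    using rogers_L_five_term[of x y] assms by simp
qed

section \<open>Evaluation at arguments in the field generated by \<open>sqrt 3\<close>\<close>

lemma rogers_L_half: "rogers_L (1 / 2) = pi\<^sup>2 / 12"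
  using rogers_L_reflect[of "1 / 2"] by simp

lemma rogers_L_two_minus_sqrt3:
  "8 * rogers_L (2 - sqrt 3) + rogers_L ((2 - sqrt 3) / 4) = 5 * pi\<^sup>2 / 12"
proof -
  define r :: real where "r = sqrt 3"
  have rr: "r * r = 3"
    by (simp add: r_def)
  \<comment> \<open>These bounds place all arguments below strictly between 0 and 1.\<close>
  have "1.732 < r"
    unfolding r_def by (rule real_less_rsqrt) (simp add: power2_eq_square)
  moreover have "r < 1.7321"
    unfolding r_def by (rule real_less_lsqrt) (simp_all add: power2_eq_square)
  ultimately have r: "1.732 < r" "r < 1.7321" .
  \<comment> \<open>\<open>R1\<close> and \<open>R2\<close> are diagonal cases \<open>x = y\<close>,
    where both quotients equal \<open>x / (1 + x)\<close>. \<open>R5\<close> brings in the target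
    \<open>(2 - r) / 4\<close>.\<close>
  have R1: "rogers_L (r - 1) + rogers_L (r - 1) =
      rogers_L (4 - 2 * r) + rogers_L (1 - r / 3) + rogers_L (1 - r / 3)"
    by (rule rogers_L_five_term') (use r rr in \<open>simp_all add: field_simps\<close>)
  have R2: "rogers_L ((r - 1) / 2) + rogers_L ((r - 1) / 2) =
      rogers_L (1 - r / 2) + rogers_L (2 - r) + rogers_L (2 - r)"
    by (rule rogers_L_five_term') (use r rr in \<open>simp_all add: field_simps\<close>)
  have R3: "rogers_L (1 / 2 + r / 6) + rogers_L (4 * r - 6) =
      rogers_L (r - 1) + rogers_L (1 / 2 - r / 6) + rogers_L (r - 1)"
    by (rule rogers_L_five_term') (use r rr in \<open>simp_all add: field_simps\<close>)
  have R4: "rogers_L (1 / 2) + rogers_L (r - 1) =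
      rogers_L ((r - 1) / 2) + rogers_L (1 / 2 - r / 6) + rogers_L (r / 3)"
    by (rule rogers_L_five_term') (use r rr in \<open>simp_all add: field_simps\<close>)
  have R5: "rogers_L (1 / 2) + rogers_L (4 * r - 6) =
      rogers_L (2 * r - 3) + rogers_L ((2 - r) / 4) + rogers_L (r / 2)"
    by (rule rogers_L_five_term') (use r rr in \<open>simp_all add: field_simps\<close>)
  have "rogers_L (r - 1) + rogers_L (2 - r) = pi\<^sup>2 / 6"
    "rogers_L (4 - 2 * r) + rogers_L (2 * r - 3) = pi\<^sup>2 / 6"
    "rogers_L (1 - r / 3) + rogers_L (r / 3) = pi\<^sup>2 / 6"
    "rogers_L (1 - r / 2) + rogers_L (r / 2) = pi\<^sup>2 / 6"
    "rogers_L (1 / 2 + r / 6) + rogers_L (1 / 2 - r / 6) = pi\<^sup>2 / 6"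
    using rogers_L_reflect[of "r - 1"] rogers_L_reflect[of "4 - 2 * r"]
      rogers_L_reflect[of "1 - r / 3"] rogers_L_reflect[of "1 - r / 2"]
      rogers_L_reflect[of "1 / 2 + r / 6"] r by (simp_all add: algebra_simps)
  \<comment> \<open>With each equation read as left side minus right side, the combination is
    \<open>R3 - R1 - R2 - 2 * R4 - R5\<close>; the reflections cancel every other value of
    \<open>rogers_L\<close>.\<close>
  with R1 R2 R3 R4 R5 rogers_L_half
  have "8 * rogers_L (2 - r) + rogers_L ((2 - r) / 4) = 5 * pi\<^sup>2 / 12"
    by linarith
  then show ?thesis
    by (simp add: r_def)
qed

theorem theorem2:
  shows "8 * Li2 (2 - sqrt 3) - Li2 (4 * sqrt 3 - 7)
       = 5 * pi\<^sup>2 / 12 + ln (2 - sqrt 3) * ln (2 + sqrt 3)"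
proof -
  define a :: real where "a = 2 - sqrt 3"
  have a: "0 < a" "a < 1"
    unfolding a_def by (auto intro!: real_less_rsqrt real_less_lsqrt simp: power2_eq_square)
  have sq: "1 + a\<^sup>2 = 4 * a" and neg: "4 * sqrt 3 - 7 = - a\<^sup>2"
    unfolding a_def by (simp_all add: power2_eq_square algebra_simps)
  \<comment> \<open>Both hold because \<open>a * (4 - a) = 1\<close>: \<open>a\<close> and
    \<open>2 + sqrt 3\<close> are conjugates of norm 1.\<close>
  have inv: "2 + sqrt 3 = inverse a" and comp: "1 - a / 4 = inverse (4 * a)"
    using a unfolding a_def by (simp_all add: divide_simps algebra_simps)
  \<comment> \<open>As \<open>(1 - a)\<^sup>2 = 2 * a\<close>, this logarithm too is a combination
    of \<open>ln 2\<close> and \<open>ln a\<close>.\<close>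
  have "2 * ln (1 - a) = ln ((1 - a)\<^sup>2)"
    using a by (simp add: ln_realpow)
  also have "(1 - a)\<^sup>2 = 2 * a"
    using sq by (simp add: power2_eq_square algebra_simps)
  finally have ln_comp: "ln (1 - a) = (ln 2 + ln a) / 2"
    using a by (simp add: ln_mult)
  have ln4: "ln (4::real) = 2 * ln 2"
    using ln_realpow[of 2 2] by simp
  have ln_quarter: "ln (a / 4) = ln a - 2 * ln 2" "ln (1 - a / 4) = - 2 * ln 2 - ln a"
    unfolding comp using a by (simp_all add: ln_div ln_mult ln_inverse ln4)
  have "a\<^sup>2 / (1 + a\<^sup>2) = a / 4"
    unfolding sq using a by (simp add: power2_eq_square field_simps)
  moreover have "a\<^sup>2 < 1"
    using a by (simp add: power_less_one_iff)
  ultimately have "Li2 (- a\<^sup>2) + Li2 (a / 4) = - (2 * ln 2 + ln a)\<^sup>2 / 2"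
    using Li2_Landen[of "a\<^sup>2"] a by (simp only: sq) (simp add: ln_mult ln4)
  moreover have "8 * Li2 a + 2 * ln a * (ln 2 + ln a) + Li2 (a / 4)
      + (ln a - 2 * ln 2) * (- 2 * ln 2 - ln a) / 2 = 5 * pi\<^sup>2 / 12"
    using rogers_L_two_minus_sqrt3 unfolding a_def[symmetric] rogers_L_def ln_comp ln_quarter
    by (simp add: field_simps)
  \<comment> \<open>Subtracting eliminates \<open>Li2 (a / 4)\<close>; all terms with
    \<open>ln 2\<close> cancel and only \<open>- (ln a)\<^sup>2\<close> survives.\<close>
  ultimately have "8 * Li2 a - Li2 (- a\<^sup>2) = 5 * pi\<^sup>2 / 12 + ln a * - ln a"
    by (simp add: power2_eq_square field_simps)
  then show ?thesis
    unfolding neg inv a_def[symmetric] using a by (simp add: ln_inverse)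
qed

end
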